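(* Let $\mathbb{X}$ be a reflexive complex Banach space and let $\mathbb{Y}$ be any complex Banach space. Let $T, A \in \mathbb{K}(\mathbb{X},\mathbb{Y})$. Then $T \perp_B A$ if and only if for each $\alpha \in U$ there exist $x = x(\alpha),\ y = y(\alpha) \in M_T$ such that $Ax \in (Tx)_\alpha^{+}$ and $Ay \in (Ty)_\alpha^{-}$.
   Context: $\mathbb{K}(\mathbb{X},\mathbb{Y})$ is the space of compact linear operators from $\mathbb{X}$ to $\mathbb{Y}$ with the operator norm, $S_{\mathbb{X}} = \{x \in \mathbb{X} : \|x\| = 1\}$, and $M_T = \{x \in S_{\mathbb{X}} : \|Tx\| = \|T\|\}$. For operators, $T \perp_B A$ (Birkhoff-James orthogonality) means $\|T + \lambda A\| \ge \|T\|$ for all $\lambda \in \mathbb{C}$. $U = \{\alpha \in \mathbb{C} : |\alpha| = 1,\ \arg \alpha \in [0,\pi)\}$. For an element $u$ of a complex Banach space $\mathbb{Z}$ and $\alpha \in U$ define $$u_\alpha^{+} = \{v \in \mathbb{Z} : \|u + t\alpha v\| \ge \|u\| \text{ for all real } t \ge 0\},\qquad u_\alpha^{-} = \{v \in \mathbb{Z} : \|u + t\alpha v\| \ge \|u\| \text{ for all real } t \le 0\}.$$ *)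

theory Defs
  imports "HOL-Analysis.Analysis"
begin

class complex_normed_vector = real_normed_vector +
  fixes scaleC :: "complex \<Rightarrow> 'a \<Rightarrow> 'a"  (infixr \<open>*\<^sub>C\<close> 75)
  assumes scaleC_add_right: "a *\<^sub>C (x + y) = a *\<^sub>C x + a *\<^sub>C y"
    and scaleC_add_left: "(a + b) *\<^sub>C x = a *\<^sub>C x + b *\<^sub>C x"
    and scaleC_scaleC: "a *\<^sub>C (b *\<^sub>C x) = (a * b) *\<^sub>C x"
    and scaleC_one: "1 *\<^sub>C x = x"
    and scaleR_scaleC: "r *\<^sub>R x = complex_of_real r *\<^sub>C x"
    and norm_scaleC: "norm (a *\<^sub>C x) = cmod a * norm x"

class complex_banach = complex_normed_vector + complete_space

subclass (in complex_banach) banach ..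

instantiation complex :: complex_banach
begin

definition scaleC_complex :: "complex \<Rightarrow> complex \<Rightarrow> complex"
  where "scaleC_complex a x = a * x"

instance
  by standard
    (simp_all add: scaleC_complex_def algebra_simps norm_mult scaleR_conv_of_real)

end

lemma vector_space_scaleC:
  "vector_space (scaleC :: complex \<Rightarrow> 'a \<Rightarrow> 'a::complex_normed_vector)"
  by standard
    (simp_all add: scaleC_add_right scaleC_add_left scaleC_scaleC scaleC_one)

definition clinear :: "('a::complex_normed_vector \<Rightarrow> 'b::complex_normed_vector) \<Rightarrow> bool"
  where "clinear f \<longleftrightarrow> Vector_Spaces.linear scaleC scaleC f"

definition bounded_clinear :: "('a::complex_normed_vector \<Rightarrow> 'b::complex_normed_vector) \<Rightarrow> bool"
  where "bounded_clinear f \<longleftrightarrow> clinear f \<and> (\<exists>K. \<forall>x. norm (f x) \<le> K * norm x)"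

text \<open>
  The continuous dual is the set of bounded complex-linear functionals, with
  pointwise operations and the norm \<^const>\<open>onorm\<close>.
\<close>

definition dual :: "('a::complex_normed_vector \<Rightarrow> complex) set"
  where "dual = {f. bounded_clinear f}"

text \<open>
  Elements of the bidual are represented by functions on all of
  \<open>'a \<Rightarrow> complex\<close>; only their values on \<^const>\<open>dual\<close> are meaningful.
\<close>

definition bidual :: "(('a::complex_normed_vector \<Rightarrow> complex) \<Rightarrow> complex) set"
  where "bidual = {\<Phi>.
    (\<forall>f\<in>dual. \<forall>g\<in>dual. \<Phi> (\<lambda>x. f x + g x) = \<Phi> f + \<Phi> g) \<and>
    (\<forall>f\<in>dual. \<forall>c. \<Phi> (\<lambda>x. c * f x) = c * \<Phi> f) \<and>
    (\<exists>K. \<forall>f\<in>dual. cmod (\<Phi> f) \<le> K * onorm f)}"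

text \<open>Reflexivity: the canonical embedding into the bidual is onto.\<close>

definition reflexive_space :: "'a::complex_normed_vector itself \<Rightarrow> bool"
  where "reflexive_space _ \<longleftrightarrow>
    (\<forall>\<Phi> \<in> (bidual :: (('a \<Rightarrow> complex) \<Rightarrow> complex) set). \<exists>x::'a. \<forall>f\<in>dual. \<Phi> f = f x)"

definition compact_operators ::
    "('a::complex_normed_vector \<Rightarrow> 'b::complex_normed_vector) set"
  where "compact_operators =
    {T. clinear T \<and> (\<forall>B. bounded B \<longrightarrow> compact (closure (T ` B)))}"

definition birkhoff_james_orthogonal ::
    "('a::complex_normed_vector \<Rightarrow> 'b::complex_normed_vector) \<Rightarrow> ('a \<Rightarrow> 'b) \<Rightarrow> bool"
    (infix \<open>\<bottom>\<^sub>B\<close> 50)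
  where "T \<bottom>\<^sub>B A \<longleftrightarrow> (\<forall>c. onorm (\<lambda>x. T x + c *\<^sub>C A x) \<ge> onorm T)"

definition norm_attaining_set ::
    "('a::complex_normed_vector \<Rightarrow> 'b::complex_normed_vector) \<Rightarrow> 'a set"
  where "norm_attaining_set T = {x \<in> sphere 0 1. norm (T x) = onorm T}"

definition upper_unit_arc :: "complex set"
  where "upper_unit_arc = {\<alpha>. cmod \<alpha> = 1 \<and> Arg \<alpha> \<in> {0..<pi}}"

definition plus_part :: "'a::complex_normed_vector \<Rightarrow> complex \<Rightarrow> 'a set"
  where "plus_part u \<alpha> = {v. \<forall>t::real. t \<ge> 0 \<longrightarrow> norm (u + (complex_of_real t * \<alpha>) *\<^sub>C v) \<ge> norm u}"

definition minus_part :: "'a::complex_normed_vector \<Rightarrow> complex \<Rightarrow> 'a set"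
  where "minus_part u \<alpha> = {v. \<forall>t::real. t \<le> 0 \<longrightarrow> norm (u + (complex_of_real t * \<alpha>) *\<^sub>C v) \<ge> norm u}"

end

theory Submission
  imports Defs
begin

text \<open>
  One direction is pointwise. Every complex \<open>c\<close> is \<open>t * \<alpha>\<close> with \<open>t\<close> real and \<open>\<alpha>\<close> on the
  upper unit arc, so one of the two given norm attaining vectors \<open>x\<close> satisfies
  \<open>\<parallel>T + c A\<parallel> \<ge> \<parallel>T x + c A x\<parallel> \<ge> \<parallel>T x\<parallel> = \<parallel>T\<parallel>\<close>.

  For the converse, fix a direction \<open>\<beta>\<close> with \<open>\<parallel>T + t \<beta> A\<parallel> \<ge> \<parallel>T\<parallel>\<close> for all \<open>t \<ge> 0\<close>; the two halves
  of the claim are \<open>\<beta> = \<alpha>\<close> and \<open>\<beta> = - \<alpha>\<close>. For small \<open>\<epsilon>\<close> choose \<open>x\<^sub>\<epsilon>\<close> in the unit ball at which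
  \<open>T + \<epsilon> \<beta> A\<close> comes within \<open>\<epsilon>\<^sup>2\<close> of its norm. Since \<open>t \<mapsto> \<parallel>T x\<^sub>\<epsilon> + t \<beta> A x\<^sub>\<epsilon>\<parallel>\<close> is convex, is at
  most \<open>\<parallel>T\<parallel>\<close> at \<open>0\<close> and at least \<open>\<parallel>T\<parallel> - \<epsilon>\<^sup>2\<close> at \<open>\<epsilon>\<close>, it is at least \<open>\<parallel>T\<parallel> - t \<epsilon>\<close> at every
  \<open>t \<ge> \<epsilon>\<close> (\<open>norm_line_lower_bound\<close>). If the pairs \<open>(T x\<^sub>\<epsilon>, A x\<^sub>\<epsilon>)\<close> accumulate at some
  \<open>(T x, A x)\<close> with \<open>\<parallel>x\<parallel> \<le> 1\<close>, then in the limit \<open>\<parallel>T x + t \<beta> A x\<parallel> \<ge> \<parallel>T\<parallel>\<close> for all \<open>t \<ge> 0\<close>, and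
  \<open>t = 0\<close> shows that \<open>x\<close> attains the norm of \<open>T\<close> (\<open>one_sided_orthogonality_attained\<close>).

  Such an accumulation point exists because \<open>x \<mapsto> (T x, A x)\<close> maps the unit ball onto a compact set
  (\<open>compact_image_unit_ball_pair\<close>). Compactness of the operators makes the image
  relatively compact; reflexivity makes it closed. Closedness is obtained directly from the
  surjectivity of the canonical embedding, without weak sequential compactness: a limit point \<open>z\<close>
  of \<open>P\<close> on the unit ball prescribes the values \<open>g z\<close> on the functionals \<open>g \<circ> P\<close>, this extends
  to a functional of norm at most one on the dual of the domain, and a vector representing the
  extension is a preimage of \<open>z\<close> (\<open>closed_image_unit_ball\<close>). Both the extension and the norming
  functionals come from the Hahn--Banach theorem in its sublinear form, which is proved here by
  passing to minimal sublinear functionals.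
\<close>

section \<open>Sublinear functionals and the Hahn--Banach theorem\<close>

definition sublinear :: "('v::real_vector \<Rightarrow> real) \<Rightarrow> bool"
  where "sublinear p \<longleftrightarrow>
    (\<forall>v w. p (v + w) \<le> p v + p w) \<and> (\<forall>r v. 0 \<le> r \<longrightarrow> p (r *\<^sub>R v) = r * p v)"

lemma sublinear_add: "sublinear p \<Longrightarrow> p (v + w) \<le> p v + p w"
  by (simp add: sublinear_def)

lemma sublinear_scale: "sublinear p \<Longrightarrow> 0 \<le> r \<Longrightarrow> p (r *\<^sub>R v) = r * p v"
  by (simp add: sublinear_def)

lemma sublinear_zero: "sublinear p \<Longrightarrow> p 0 = 0"
  using sublinear_scale[of p 0 0] by simp

lemma sublinear_lower_bound:
  assumes "sublinear p"
  shows "- p (- v) \<le> p v"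
  using sublinear_add[OF assms, of v "- v"] sublinear_zero[OF assms] by simp

lemma sublinearI:
  assumes add: "\<And>v w. p (v + w) \<le> p v + p w"
    and scale: "\<And>r v. 0 < r \<Longrightarrow> p (r *\<^sub>R v) \<le> r * p v"
  shows "sublinear p"
  unfolding sublinear_def
proof (intro conjI allI impI add)
  fix r :: real and v
  have zero: "p 0 = 0"
    using scale[of "1/2" 0] add[of 0 0] by simp
  assume "0 \<le> r"
  show "p (r *\<^sub>R v) = r * p v"
  proof (cases "r = 0")
    case True
    then show ?thesis by (simp add: zero)
  next
    case False
    with \<open>0 \<le> r\<close> have r: "0 < r" by simp
    have "p (inverse r *\<^sub>R (r *\<^sub>R v)) \<le> inverse r * p (r *\<^sub>R v)"
      using r by (intro scale) simp
    then have "p v \<le> inverse r * p (r *\<^sub>R v)"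
      using r by simp
    then have "r * p v \<le> p (r *\<^sub>R v)"
      using r by (simp add: field_simps)
    then show ?thesis
      using scale[OF r, of v] by simp
  qed
qed

text \<open>
  The infimum of a single family is used three times below: for chains of functionals, for lowering
  a functional at a point, and for the inf-convolution in Helly's argument. The index \<open>k\<close> in
  the hypotheses may depend on the vectors, which is what chains need.
\<close>

lemma sublinear_INF:
  fixes f :: "'i \<Rightarrow> 'v::real_vector \<Rightarrow> real"
  assumes nonempty: "I \<noteq> {}"
    and bdd: "\<And>v. bdd_below ((\<lambda>i. f i v) ` I)"
    and add: "\<And>i j v w. i \<in> I \<Longrightarrow> j \<in> I \<Longrightarrow> \<exists>k\<in>I. f k (v + w) \<le> f i v + f j w"
    and scale: "\<And>i r v. i \<in> I \<Longrightarrow> 0 < r \<Longrightarrow> \<exists>k\<in>I. f k (r *\<^sub>R v) \<le> r * f i v"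
  shows "sublinear (\<lambda>v. INF i\<in>I. f i v)"
proof (rule sublinearI)
  fix v w
  have "(INF i\<in>I. f i (v + w)) - f i v \<le> f j w" if ij: "i \<in> I" "j \<in> I" for i j
  proof -
    obtain k where "k \<in> I" "f k (v + w) \<le> f i v + f j w"
      using add[OF ij] by blast
    moreover have "(INF i\<in>I. f i (v + w)) \<le> f k (v + w)"
      by (rule cINF_lower[OF bdd \<open>k \<in> I\<close>])
    ultimately show ?thesis by simp
  qed
  then have "(INF i\<in>I. f i (v + w)) - f i v \<le> (INF j\<in>I. f j w)" if "i \<in> I" for i
    using that by (intro cINF_greatest nonempty) auto
  then have "(INF i\<in>I. f i (v + w)) - (INF j\<in>I. f j w) \<le> f i v" if "i \<in> I" for i
    using that by (auto simp: algebra_simps)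
  then have "(INF i\<in>I. f i (v + w)) - (INF j\<in>I. f j w) \<le> (INF i\<in>I. f i v)"
    by (intro cINF_greatest nonempty) auto
  then show "(INF i\<in>I. f i (v + w)) \<le> (INF i\<in>I. f i v) + (INF i\<in>I. f i w)"
    by simp
next
  fix r :: real and v
  assume r: "0 < r"
  have "(INF i\<in>I. f i (r *\<^sub>R v)) / r \<le> f i v" if i: "i \<in> I" for i
  proof -
    obtain k where "k \<in> I" "f k (r *\<^sub>R v) \<le> r * f i v"
      using scale[OF i r] by blast
    moreover have "(INF i\<in>I. f i (r *\<^sub>R v)) \<le> f k (r *\<^sub>R v)"
      by (rule cINF_lower[OF bdd \<open>k \<in> I\<close>])
    ultimately show ?thesis
      using r by (simp add: field_simps)
  qed
  then have "(INF i\<in>I. f i (r *\<^sub>R v)) / r \<le> (INF i\<in>I. f i v)"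
    by (intro cINF_greatest nonempty) auto
  then show "(INF i\<in>I. f i (r *\<^sub>R v)) \<le> r * (INF i\<in>I. f i v)"
    using r by (simp add: field_simps)
qed

text \<open>
  The lowered functional is \<open>v \<mapsto> inf\<^sub>t (p (v + t y) - t p y)\<close> over \<open>t \<ge> 0\<close>. It serves twice: its
  bound by \<open>p (v + y) - p y\<close> forces minimal functionals to be additive, and its value at \<open>- y\<close>
  forces every linear functional below it to agree with \<open>p\<close> at \<open>y\<close>.
\<close>

lemma sublinear_lower_at:
  fixes p :: "'v::real_vector \<Rightarrow> real"
  assumes p: "sublinear p"
  obtains q where "sublinear q" "q \<le> p" "q (- y) \<le> - p y"
    "\<And>v. q v \<le> p (v + y) - p y"
proof -
  let ?f = "\<lambda>t v. p (v + t *\<^sub>R y) - t * p y"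
  let ?q = "\<lambda>v. INF t\<in>{0..}. ?f t v"
  have bdd: "bdd_below ((\<lambda>t. ?f t v) ` {0..})" for v
  proof (rule bdd_belowI2)
    fix t :: real
    assume "t \<in> {0..}"
    then have "t * p y = p ((v + t *\<^sub>R y) + - v)"
      by (simp add: sublinear_scale[OF p])
    also have "\<dots> \<le> p (v + t *\<^sub>R y) + p (- v)"
      by (rule sublinear_add[OF p])
    finally show "- p (- v) \<le> ?f t v" by simp
  qed
  have "sublinear ?q"
  proof (rule sublinear_INF)
    fix s t :: real and v w
    assume "s \<in> {0..}" "t \<in> {0..}"
    moreover have "p ((v + s *\<^sub>R y) + (w + t *\<^sub>R y)) \<le> p (v + s *\<^sub>R y) + p (w + t *\<^sub>R y)"
      by (rule sublinear_add[OF p])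
    ultimately show "\<exists>k\<in>{0..}. ?f k (v + w) \<le> ?f s v + ?f t w"
      by (intro bexI[of _ "s + t"]) (auto simp: algebra_simps)
  next
    fix t r :: real and v
    assume "t \<in> {0..}" "0 < r"
    then have "p (r *\<^sub>R (v + t *\<^sub>R y)) = r * p (v + t *\<^sub>R y)"
      by (simp add: sublinear_scale[OF p])
    then show "\<exists>k\<in>{0..}. ?f k (r *\<^sub>R v) \<le> r * ?f t v"
      using \<open>t \<in> {0..}\<close> \<open>0 < r\<close>
      by (intro bexI[of _ "r * t"]) (auto simp: algebra_simps)
  qed (auto intro: bdd)
  moreover have le: "?q v \<le> ?f t v" if "0 \<le> t" for t v
    using that by (intro cINF_lower[OF bdd]) auto
  have "?q \<le> p"
    using le[of 0] by (simp add: le_fun_def)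
  moreover have *: "?q v \<le> p (v + y) - p y" for v
    using le[of 1 v] by simp
  have "?q (- y) \<le> - p y"
    using *[of "- y"] by (simp add: sublinear_zero[OF p])
  ultimately show thesis
    using * by (rule that)
qed

text \<open>
  Zorn's lemma applies because every sublinear \<open>q \<le> p\<close> satisfies \<open>q v \<ge> - q (- v) \<ge> - p (- v)\<close>,
  so that the pointwise infimum of a chain is finite.
\<close>

lemma exists_minimal_sublinear:
  fixes p :: "'v::real_vector \<Rightarrow> real"
  assumes p: "sublinear p"
  obtains q where "sublinear q" "q \<le> p" "\<And>q'. sublinear q' \<Longrightarrow> q' \<le> q \<Longrightarrow> q' = q"
proof -
  define S where "S = {q. sublinear q \<and> q \<le> p}"
  have "\<exists>m\<in>S. \<forall>a\<in>S. a \<le> m \<longrightarrow> a = m"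
  proof (rule predicate_Zorn)
    show "partial_order_on S (relation_of (\<lambda>a b. b \<le> a) S)"
      by (rule partial_order_on_relation_ofI) auto
  next
    fix C
    assume "C \<in> Chains (relation_of (\<lambda>a b. b \<le> a) S)"
    then have CS: "C \<subseteq> S" and chain: "\<And>a b. a \<in> C \<Longrightarrow> b \<in> C \<Longrightarrow> a \<le> b \<or> b \<le> a"
      by (auto simp: Chains_def relation_of_def)
    show "\<exists>u\<in>S. \<forall>a\<in>C. u \<le> a"
    proof (cases "C = {}")
      case True
      then show ?thesis using p by (auto simp: S_def)
    next
      case False
      let ?u = "\<lambda>v. INF q\<in>C. q v"
      have bdd: "bdd_below ((\<lambda>q. q v) ` C)" for v
      proof (rule bdd_belowI2)
        fix q
        assume "q \<in> C"
        then have "sublinear q" "q (- v) \<le> p (- v)"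
          using CS by (auto simp: S_def le_fun_def)
        then show "- p (- v) \<le> q v"
          using sublinear_lower_bound[of q v] by simp
      qed
      have lower: "?u v \<le> q v" if "q \<in> C" for q v
        by (rule cINF_lower[OF bdd that])
      have "sublinear ?u"
      proof (rule sublinear_INF[OF False bdd])
        fix a b v w
        assume ab: "a \<in> C" "b \<in> C"
        then have "sublinear a" "sublinear b"
          using CS by (auto simp: S_def)
        then have "a (v + w) \<le> a v + a w" "b (v + w) \<le> b v + b w"
          by (simp_all add: sublinear_add)
        moreover from chain[OF ab] have "a w \<le> b w \<or> b v \<le> a v"
          by (auto simp: le_fun_def)
        ultimately have "a (v + w) \<le> a v + b w \<or> b (v + w) \<le> a v + b w"
          by linarith
        then show "\<exists>k\<in>C. k (v + w) \<le> a v + b w"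
          using ab by blast
      next
        fix a v and r :: real
        assume "a \<in> C" "0 < r"
        then show "\<exists>k\<in>C. k (r *\<^sub>R v) \<le> r * a v"
          using CS by (intro bexI[of _ a]) (auto simp: S_def sublinear_scale)
      qed
      moreover have "?u \<le> p"
      proof -
        obtain q where "q \<in> C" using False by blast
        then show ?thesis
          using lower[OF \<open>q \<in> C\<close>] CS by (force simp: S_def le_fun_def intro: order_trans)
      qed
      ultimately show ?thesis
        using lower by (intro bexI[of _ ?u]) (auto simp: S_def le_fun_def)
    qed
  qed
  then obtain m where "m \<in> S" and min: "\<And>a. a \<in> S \<Longrightarrow> a \<le> m \<Longrightarrow> a = m"
    by blast
  show thesis
  proof (rule that)
    show "sublinear m" "m \<le> p" using \<open>m \<in> S\<close> by (auto simp: S_def)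
    then show "q' = m" if "sublinear q'" "q' \<le> m" for q'
      using that min by (auto simp: S_def intro: order_trans)
  qed
qed

text \<open>
  Lowering a minimal \<open>q\<close> at \<open>w\<close> changes nothing, so \<open>q v \<le> q (v + w) - q w\<close>: a minimal
  functional is superadditive as well as subadditive.
\<close>

lemma minimal_sublinear_imp_linear:
  fixes q :: "'v::real_vector \<Rightarrow> real"
  assumes q: "sublinear q" and min: "\<And>q'. sublinear q' \<Longrightarrow> q' \<le> q \<Longrightarrow> q' = q"
  shows "linear q"
proof -
  have add: "q (v + w) = q v + q w" for v w
  proof -
    obtain q' where q': "sublinear q'" "q' \<le> q" "q' v \<le> q (v + w) - q w"
      using sublinear_lower_at[OF q, of w] by metis
    then have "q v \<le> q (v + w) - q w"
      using min by metis
    then show ?thesis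
      using sublinear_add[OF q, of v w] by simp
  qed
  have neg: "q (- v) = - q v" for v
    using add[of v "- v"] sublinear_zero[OF q] by simp
  have "q (r *\<^sub>R v) = r * q v" for r v
  proof (cases "0 \<le> r")
    case True
    then show ?thesis by (rule sublinear_scale[OF q])
  next
    case False
    then have "q ((- r) *\<^sub>R v) = (- r) * q v"
      by (intro sublinear_scale[OF q]) simp
    then show ?thesis using neg[of "r *\<^sub>R v"] by simp
  qed
  with add show ?thesis by (intro linearI) auto
qed

text \<open>
  A minimal functional below \<open>p\<close> is linear; lowering \<open>p\<close> at \<open>y\<close> beforehand gives
  \<open>\<phi> (- y) \<le> - p y\<close> and hence equality at \<open>y\<close>.
\<close>

theorem hahn_banach_sublinear:
  fixes p :: "'v::real_vector \<Rightarrow> real"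
  assumes p: "sublinear p"
  obtains \<phi> where "linear \<phi>" "\<And>v. \<phi> v \<le> p v" "\<phi> y = p y"
proof -
  obtain p' where p': "sublinear p'" "p' \<le> p" "p' (- y) \<le> - p y"
    using sublinear_lower_at[OF p, of y] by metis
  obtain \<phi> where \<phi>: "sublinear \<phi>" "\<phi> \<le> p'" "\<And>q. sublinear q \<Longrightarrow> q \<le> \<phi> \<Longrightarrow> q = \<phi>"
    using exists_minimal_sublinear[OF p'(1)] by metis
  then have lin: "linear \<phi>"
    by (intro minimal_sublinear_imp_linear)
  have le: "\<phi> v \<le> p v" for v
    using \<phi>(2) p'(2) by (meson le_funD order_trans)
  have "\<phi> (- y) \<le> - p y"
    using \<phi>(2) p'(3) by (meson le_funD order_trans)
  then have "\<phi> y = p y"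
    using le[of y] linear_neg[OF lin, of y] by simp
  with lin le show thesis by (rule that)
qed

lemma exists_norming_functional:
  fixes y :: "'v::real_normed_vector"
  obtains g :: "'v \<Rightarrow>\<^sub>L real" where "norm g \<le> 1" "blinfun_apply g y = norm y"
proof -
  have "sublinear (norm :: 'v \<Rightarrow> real)"
    by (rule sublinearI) (auto intro: norm_triangle_ineq)
  then obtain \<phi> where \<phi>: "linear \<phi>" "\<And>v. \<phi> v \<le> norm v" "\<phi> y = norm y"
    by (rule hahn_banach_sublinear[of norm y]) auto
  have abs: "\<bar>\<phi> v\<bar> \<le> norm v" for v
    using \<phi>(2)[of v] \<phi>(2)[of "- v"] linear_neg[OF \<phi>(1), of v] by simp
  then have bl: "bounded_linear \<phi>"
    using \<phi>(1) by (intro bounded_linear_intro[where K = 1])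
      (auto simp: linear_add linear_cmul)
  show thesis
  proof (rule that[of "Blinfun \<phi>"])
    show "norm (Blinfun \<phi>) \<le> 1"
      using abs by (intro norm_blinfun_bound) (auto simp: bounded_linear_Blinfun_apply[OF bl])
    show "blinfun_apply (Blinfun \<phi>) y = norm y"
      by (simp add: bounded_linear_Blinfun_apply[OF bl] \<phi>(3))
  qed
qed

section \<open>Complex-linear maps and reflexivity in real terms\<close>

lemma clinear_iff:
  "clinear f \<longleftrightarrow> (\<forall>x y. f (x + y) = f x + f y) \<and> (\<forall>c x. f (c *\<^sub>C x) = c *\<^sub>C f x)"
  unfolding clinear_def linear_iff_module_hom
  by (auto simp: module_hom_iff vector_space_scaleC[unfolded vector_space_def] module_def
      scaleC_add_right scaleC_add_left scaleC_scaleC scaleC_one)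

lemma clinear_imp_linear:
  assumes "clinear f"
  shows "linear f"
  using assms by (intro linearI) (auto simp: clinear_iff scaleR_scaleC)

lemma bounded_clinear_imp_bounded_linear:
  assumes "bounded_clinear f"
  shows "bounded_linear f"
proof -
  obtain K where "\<And>x. norm (f x) \<le> K * norm x" and "clinear f"
    using assms by (auto simp: bounded_clinear_def)
  then show ?thesis
    using clinear_imp_linear[of f]
    by (intro bounded_linear_intro[where K = K]) (auto simp: linear_add linear_cmul mult.commute)
qed

lemma bounded_linear_scaleC: "bounded_linear (scaleC c)"
  by (rule bounded_linear_intro[where K = "cmod c"])
    (auto simp: scaleC_add_right norm_scaleC scaleR_scaleC scaleC_scaleC mult.commute)

text \<open>
  The image of the unit ball has compact closure and is therefore bounded; rescaling turns this
  into a bound for the operator.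
\<close>

lemma compact_operator_bounded_linear:
  assumes T: "T \<in> compact_operators"
  shows "bounded_linear T"
proof -
  have lin: "linear T"
    using T by (auto simp: compact_operators_def intro: clinear_imp_linear)
  have "compact (closure (T ` cball 0 1))"
    using T by (auto simp: compact_operators_def)
  then have "bounded (T ` cball 0 1)"
    by (meson bounded_subset closure_subset compact_imp_bounded)
  then obtain K where K: "\<And>x. norm x \<le> 1 \<Longrightarrow> norm (T x) \<le> K"
    unfolding bounded_iff by (metis imageI mem_cball_0)
  have "norm (T x) \<le> norm x * K" for x
  proof (cases "x = 0")
    case True
    then show ?thesis by (simp add: linear_0[OF lin])
  next
    case False
    then have "norm (T (x /\<^sub>R norm x)) \<le> K"
      by (intro K) simp
    then show ?thesis
      using False by (simp add: linear_cmul[OF lin] field_simps)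
  qed
  then show ?thesis
    using lin by (intro bounded_linear_intro[where K = K]) (auto simp: linear_add linear_cmul)
qed

text \<open>
  This is the usual passage \<open>f x = h x - \<i> h (\<i> x)\<close> from a real functional to the complex
  functional of which it is the real part. Through it the complex dual can be treated as the space
  of bounded real-linear functionals, where the real Hahn--Banach theorem applies.
\<close>

lemma real_functional_is_Re_of_dual:
  fixes h :: "'a::complex_normed_vector \<Rightarrow>\<^sub>L real"
  shows "(\<lambda>x. Complex (h x) (- h (\<i> *\<^sub>C x))) \<in> dual"
proof -
  let ?f = "\<lambda>x. Complex (h x) (- h (\<i> *\<^sub>C x))"
  have c: "c *\<^sub>C x = Re c *\<^sub>R x + Im c *\<^sub>R (\<i> *\<^sub>C x)" for c and x :: 'a
    by (simp add: scaleR_scaleC scaleC_scaleC flip: scaleC_add_left)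
       (metis complex_eq mult.commute)
  have ic: "\<i> *\<^sub>C (c *\<^sub>C x) = Re c *\<^sub>R (\<i> *\<^sub>C x) - Im c *\<^sub>R x" for c and x :: 'a
  proof -
    have "\<i> *\<^sub>C (c *\<^sub>C x) = (\<i> * c) *\<^sub>C x"
      by (simp add: scaleC_scaleC)
    also have "\<dots> = Re (\<i> * c) *\<^sub>R x + Im (\<i> * c) *\<^sub>R (\<i> *\<^sub>C x)"
      by (rule c)
    finally show ?thesis by simp
  qed
  have hom: "?f (c *\<^sub>C x) = c *\<^sub>C ?f x" for c x
    by (subst ic, subst c)
       (simp add: scaleC_complex_def complex_eq_iff blinfun.add_right blinfun.diff_right
         blinfun.scaleR_right algebra_simps)
  have add: "?f (x + y) = ?f x + ?f y" for x y
    by (simp add: complex_eq_iff blinfun.add_right scaleC_add_right)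
  have bound: "norm (?f x) \<le> (2 * norm h) * norm x" for x
  proof -
    have "norm (?f x) \<le> \<bar>h x\<bar> + \<bar>h (\<i> *\<^sub>C x)\<bar>"
      using cmod_le[of "?f x"] by simp
    also have "\<dots> \<le> norm h * norm x + norm h * norm x"
      using norm_blinfun[of h x] norm_blinfun[of h "\<i> *\<^sub>C x"]
      by (intro add_mono) (simp_all add: norm_scaleC)
    finally show ?thesis by (simp add: algebra_simps)
  qed
  show ?thesis
    unfolding dual_def bounded_clinear_def clinear_iff mem_Collect_eq
    using add hom bound by blast
qed

text \<open>
  Reflexivity speaks about complex functionals on the complex dual. Identifying \<open>f\<close> with its real
  part, \<open>\<phi>\<close> complexifies to \<open>\<Phi> f = \<phi> (Re f) - \<i> \<phi> (Re (\<i> f))\<close>, which belongs to the bidual; a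
  vector representing \<open>\<Phi>\<close> represents \<open>\<phi>\<close>.
\<close>

lemma reflexive_real_representation:
  fixes \<phi> :: "('a::complex_normed_vector \<Rightarrow>\<^sub>L real) \<Rightarrow> real"
  assumes refl: "reflexive_space TYPE('a)"
    and lin: "linear \<phi>"
    and le: "\<And>h. \<phi> h \<le> norm h"
  obtains x where "\<And>h. \<phi> h = blinfun_apply h x"
proof -
  define R :: "('a \<Rightarrow> complex) \<Rightarrow> 'a \<Rightarrow>\<^sub>L real" where "R f = Blinfun (\<lambda>x. Re (f x))" for f
  define \<Phi> where "\<Phi> f = Complex (\<phi> (R f)) (- \<phi> (R (\<lambda>x. \<i> * f x)))" for f
  have bl: "bounded_linear f" if "f \<in> dual" for f :: "'a \<Rightarrow> complex"
    using that by (auto simp: dual_def intro: bounded_clinear_imp_bounded_linear)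
  have R_apply: "blinfun_apply (R f) x = Re (f x)" if "bounded_linear f" for f x
    unfolding R_def
    by (subst bounded_linear_Blinfun_apply) (auto intro: bounded_linear_compose[OF bounded_linear_Re that])
  have bl_mult: "bounded_linear (\<lambda>x. c * f x)" if "bounded_linear f" for c and f :: "'a \<Rightarrow> complex"
    by (rule bounded_linear_compose[OF bounded_linear_mult_right that])
  have R_mult: "R (\<lambda>x. c * f x) = Re c *\<^sub>R R f + Im c *\<^sub>R R (\<lambda>x. \<i> * f x)"
    if "bounded_linear f" for c f
    by (rule blinfun_eqI)
       (simp add: R_apply that bl_mult blinfun.add_left blinfun.scaleR_left)
  have R_add: "R (\<lambda>x. f x + g x) = R f + R g" if "bounded_linear f" "bounded_linear g" for f g
    by (rule blinfun_eqI) (simp add: R_apply that bounded_linear_add blinfun.add_left)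
  have R_norm: "norm (R f) \<le> onorm f" if "bounded_linear f" for f
  proof (rule norm_blinfun_bound)
    show "0 \<le> onorm f" by (rule onorm_pos_le[OF that])
    fix x
    have "\<bar>Re (f x)\<bar> \<le> norm (f x)" by (rule abs_Re_le_cmod)
    also have "\<dots> \<le> onorm f * norm x" by (rule onorm[OF that])
    finally show "norm (blinfun_apply (R f) x) \<le> onorm f * norm x"
      by (simp add: R_apply[OF that])
  qed
  have abs: "\<bar>\<phi> h\<bar> \<le> norm h" for h
    using le[of h] le[of "- h"] linear_neg[OF lin, of h] by simp
  have "\<Phi> \<in> bidual"
    unfolding bidual_def
  proof (intro CollectI conjI ballI allI exI)
    fix f g :: "'a \<Rightarrow> complex"
    assume "f \<in> dual" "g \<in> dual"
    then show "\<Phi> (\<lambda>x. f x + g x) = \<Phi> f + \<Phi> g"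
      by (simp add: \<Phi>_def bl bl_mult R_add linear_add[OF lin] distrib_left complex_eq_iff)
  next
    fix f :: "'a \<Rightarrow> complex" and c
    assume "f \<in> dual"
    then have f: "bounded_linear f" by (rule bl)
    have "R (\<lambda>x. \<i> * (c * f x)) = Re (\<i> * c) *\<^sub>R R f + Im (\<i> * c) *\<^sub>R R (\<lambda>x. \<i> * f x)"
      using R_mult[OF f, of "\<i> * c"] by (simp only: mult.assoc)
    then show "\<Phi> (\<lambda>x. c * f x) = c * \<Phi> f"
      by (simp add: \<Phi>_def R_mult[OF f, of c] linear_add[OF lin] linear_cmul[OF lin] linear_diff[OF lin]
          linear_neg[OF lin] complex_eq_iff)
  next
    fix f :: "'a \<Rightarrow> complex"
    assume "f \<in> dual"
    then have f: "bounded_linear f" by (rule bl)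
    have "onorm (\<lambda>x. \<i> * f x) = onorm f"
      by (simp add: onorm_def norm_mult)
    then have "\<bar>\<phi> (R f)\<bar> \<le> onorm f" "\<bar>\<phi> (R (\<lambda>x. \<i> * f x))\<bar> \<le> onorm f"
      using abs R_norm[OF f] R_norm[OF bl_mult[OF f, of \<i>]] by (metis order_trans)+
    then show "cmod (\<Phi> f) \<le> 2 * onorm f"
      using cmod_le[of "\<Phi> f"] by (simp add: \<Phi>_def)
  qed
  then obtain x where x: "\<And>f. f \<in> dual \<Longrightarrow> \<Phi> f = f x"
    using refl unfolding reflexive_space_def by blast
  show thesis
  proof (rule that[of x])
    fix h :: "'a \<Rightarrow>\<^sub>L real"
    let ?f = "\<lambda>x. Complex (h x) (- h (\<i> *\<^sub>C x))"
    have f: "?f \<in> dual" by (rule real_functional_is_Re_of_dual)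
    have "R ?f = h"
      by (rule blinfun_eqI) (simp add: R_apply[OF bl[OF f]])
    then have "\<phi> h = Re (\<Phi> ?f)" by (simp add: \<Phi>_def)
    also have "\<dots> = h x" by (simp add: x[OF f])
    finally show "\<phi> h = h x" .
  qed
qed

section \<open>Images of the unit ball of a reflexive space\<close>

text \<open>
  This is Helly's argument. A vector \<open>x\<close> with \<open>\<parallel>x\<parallel> \<le> 1\<close> and \<open>P x = z\<close> is the same as a
  linear functional \<open>\<phi>\<close> on the dual with \<open>\<phi> h \<le> \<parallel>h\<parallel>\<close> and \<open>\<phi> (g \<circ> P) \<le> g z\<close>, by reflexivity and because
  norming functionals recover \<open>\<parallel>x\<parallel>\<close> and separate \<open>P x\<close> from \<open>z\<close>. The largest sublinear
  functional obeying both bounds is \<open>p h = inf\<^sub>g (\<parallel>h - g \<circ> P\<parallel> + g z)\<close>. The infimum is finite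
  precisely because \<open>\<bar>g z\<bar> \<le> \<parallel>g \<circ> P\<parallel>\<close> for every \<open>g\<close>, which holds on the image of the unit ball
  and hence on its closure.
\<close>

lemma closed_image_unit_ball:
  fixes P :: "'a::complex_normed_vector \<Rightarrow>\<^sub>L 'c::real_normed_vector"
  assumes refl: "reflexive_space TYPE('a)"
  shows "closed (P ` cball 0 1)"
proof -
  have "\<exists>x. norm x \<le> 1 \<and> P x = z" if z: "z \<in> closure (P ` cball 0 1)" for z
  proof -
    let ?f = "\<lambda>(g :: 'c \<Rightarrow>\<^sub>L real) h. norm (h - (g o\<^sub>L P)) + g z"
    let ?p = "\<lambda>h. INF g\<in>UNIV. ?f g h"
    have gz: "- g z \<le> norm (g o\<^sub>L P)" for g :: "'c \<Rightarrow>\<^sub>L real"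
    proof -
      have "closure (P ` cball 0 1) \<subseteq> {w. - g w \<le> norm (g o\<^sub>L P)}"
      proof (rule closure_minimal)
        show "closed {w. - g w \<le> norm (g o\<^sub>L P)}"
          by (intro closed_Collect_le continuous_intros)
        have "- g (P x) \<le> norm (g o\<^sub>L P)" if "norm x \<le> 1" for x
        proof -
          have "\<bar>g (P x)\<bar> \<le> norm (g o\<^sub>L P) * norm x"
            using norm_blinfun[of "g o\<^sub>L P" x] by simp
          also have "\<dots> \<le> norm (g o\<^sub>L P)"
            using that by (simp add: mult_left_le)
          finally show ?thesis by simp
        qed
        then show "P ` cball 0 1 \<subseteq> {w. - g w \<le> norm (g o\<^sub>L P)}"
          by auto
      qed
      with z show ?thesis by auto
    qed
    have bdd: "bdd_below (range (\<lambda>g. ?f g h))" for h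
    proof (rule bdd_belowI2)
      fix g :: "'c \<Rightarrow>\<^sub>L real"
      show "- norm h \<le> ?f g h"
        using gz[of g] norm_triangle_ineq2[of "g o\<^sub>L P" h] by (simp add: norm_minus_commute)
    qed
    have p_le: "?p h \<le> ?f g h" for g h
      by (rule cINF_lower[OF bdd UNIV_I])
    have "sublinear ?p"
    proof (rule sublinear_INF)
      fix g g' :: "'c \<Rightarrow>\<^sub>L real" and h h' :: "'a \<Rightarrow>\<^sub>L real"
      have eq: "(h + h') - ((g + g') o\<^sub>L P) = (h - (g o\<^sub>L P)) + (h' - (g' o\<^sub>L P))"
        by (rule blinfun_eqI) (simp add: blinfun.add_left blinfun.diff_left)
      have "?f (g + g') (h + h') \<le> ?f g h + ?f g' h'"
        unfolding eq blinfun.add_left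
        using norm_triangle_ineq[of "h - (g o\<^sub>L P)" "h' - (g' o\<^sub>L P)"] by simp
      then show "\<exists>k\<in>UNIV. ?f k (h + h') \<le> ?f g h + ?f g' h'" by blast
    next
      fix g :: "'c \<Rightarrow>\<^sub>L real" and r :: real and h :: "'a \<Rightarrow>\<^sub>L real"
      assume "0 < r"
      have eq: "r *\<^sub>R h - ((r *\<^sub>R g) o\<^sub>L P) = r *\<^sub>R (h - (g o\<^sub>L P))"
        by (rule blinfun_eqI) (simp add: blinfun.scaleR_left blinfun.diff_left algebra_simps)
      have "?f (r *\<^sub>R g) (r *\<^sub>R h) \<le> r * ?f g h"
        unfolding eq blinfun.scaleR_left using \<open>0 < r\<close> by (simp add: distrib_left)
      then show "\<exists>k\<in>UNIV. ?f k (r *\<^sub>R h) \<le> r * ?f g h" by blast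
    qed (auto intro: bdd)
    then obtain \<phi> where lin: "linear \<phi>" and \<phi>: "\<And>h. \<phi> h \<le> ?p h"
      by (rule hahn_banach_sublinear[of _ 0]) blast
    have \<phi>_le: "\<phi> h \<le> ?f g h" for g h
      using \<phi> p_le by (rule order_trans)
    \<comment> \<open>The choices \<open>g = 0\<close> here and \<open>h = g \<circ> P\<close> below give the two bounds on \<open>\<phi>\<close>.\<close>
    have \<phi>_norm: "\<phi> h \<le> norm h" for h
      using \<phi>_le[of h 0] by simp
    obtain x where x: "\<And>h. \<phi> h = blinfun_apply h x"
      using reflexive_real_representation[OF refl lin \<phi>_norm] by metis
    obtain h :: "'a \<Rightarrow>\<^sub>L real" where h: "norm h \<le> 1" "h x = norm x"
      by (rule exists_norming_functional)
    have "norm x \<le> 1"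
      using \<phi>_norm[of h] h by (simp add: x)
    moreover
    obtain g :: "'c \<Rightarrow>\<^sub>L real" where g: "g (P x - z) = norm (P x - z)"
      by (rule exists_norming_functional)
    have "g (P x) \<le> g z"
      using \<phi>_le[of "g o\<^sub>L P" g] by (simp add: x)
    then have "norm (P x - z) \<le> 0"
      using g unfolding blinfun.diff_right by linarith
    then have "P x = z" by simp
    ultimately show ?thesis by blast
  qed
  then have "closure (P ` cball 0 1) \<subseteq> P ` cball 0 1"
    by (force simp: image_iff)
  then show ?thesis
    by (simp add: closure_subset_eq)
qed

lemma compact_image_unit_ball_pair:
  fixes T A :: "'a::complex_normed_vector \<Rightarrow> 'b::complex_normed_vector"
  assumes refl: "reflexive_space TYPE('a)"
    and T: "T \<in> compact_operators" and A: "A \<in> compact_operators"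
  shows "compact ((\<lambda>x. (T x, A x)) ` cball 0 1)"
proof -
  have "bounded_linear (\<lambda>x. (T x, A x))"
    using T A by (intro bounded_linear_Pair compact_operator_bounded_linear)
  then have "closed ((\<lambda>x. (T x, A x)) ` cball 0 1)"
    using closed_image_unit_ball[OF refl, of "Blinfun (\<lambda>x. (T x, A x))"]
    by (simp add: bounded_linear_Blinfun_apply)
  moreover have "compact (closure (T ` cball 0 1) \<times> closure (A ` cball 0 1))"
    using T A by (intro compact_Times) (auto simp: compact_operators_def)
  moreover have "(\<lambda>x. (T x, A x)) ` cball 0 1
      \<subseteq> closure (T ` cball 0 1) \<times> closure (A ` cball 0 1)"
    using closure_subset[of "T ` cball 0 1"] closure_subset[of "A ` cball 0 1"] by blast
  ultimately show ?thesis
    using closed_Int_compact by (fastforce simp: Int_absorb2)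
qed

section \<open>One-sided Birkhoff--James orthogonality of compact operators\<close>

lemma exists_near_maximiser:
  assumes f: "bounded_linear f" and e: "0 < e"
  obtains x where "norm x \<le> 1" "onorm f - e \<le> norm (f x)"
proof (cases "\<exists>x. norm x \<le> 1 \<and> onorm f - e \<le> norm (f x)")
  case True
  with that show ?thesis by blast
next
  case False
  then have *: "norm (f x) < onorm f - e" if "norm x \<le> 1" for x
    using that by force
  have pos: "0 \<le> onorm f - e"
    using *[of 0] norm_ge_zero[of "f 0"] by (simp del: norm_ge_zero)
  interpret bounded_linear f by (rule f)
  have "norm (f x) \<le> (onorm f - e) * norm x" for x
  proof (cases "x = 0")
    case True
    then show ?thesis by (simp add: zero)
  next
    case False
    then have "norm (f (x /\<^sub>R norm x)) < onorm f - e"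
      by (intro *) simp
    then show ?thesis
      using False by (simp add: scaleR field_simps)
  qed
  then have "onorm f \<le> onorm f - e"
    by (rule onorm_bound[OF pos])
  with e show ?thesis by simp
qed

text \<open>
  Convexity of \<open>t \<mapsto> \<parallel>u + t v\<parallel>\<close>: the point \<open>\<epsilon>\<close> divides the segment from \<open>0\<close> to \<open>t\<close>, so a near
  maximum at \<open>\<epsilon>\<close> bounds the value at \<open>t\<close> from below. The defect \<open>\<epsilon>\<^sup>2\<close> gets multiplied by
  \<open>t / \<epsilon>\<close>, and being quadratic it still vanishes with \<open>\<epsilon>\<close>.
\<close>

lemma norm_line_lower_bound:
  fixes u v :: "'b::real_normed_vector"
  assumes u: "norm u \<le> M" and \<epsilon>: "0 < \<epsilon>" "\<epsilon> \<le> t"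
    and uv: "M - \<epsilon>\<^sup>2 \<le> norm (u + \<epsilon> *\<^sub>R v)"
  shows "M - t * \<epsilon> \<le> norm (u + t *\<^sub>R v)"
proof -
  define s where "s = \<epsilon> / t"
  have t: "0 < t" and s: "0 < s" "s \<le> 1" and st: "s * t = \<epsilon>"
    using \<epsilon> by (auto simp: s_def)
  have "u + \<epsilon> *\<^sub>R v = (1 - s) *\<^sub>R u + s *\<^sub>R (u + t *\<^sub>R v)"
    by (simp add: algebra_simps st)
  then have "norm (u + \<epsilon> *\<^sub>R v) \<le> (1 - s) * norm u + s * norm (u + t *\<^sub>R v)"
    using norm_triangle_ineq[of "(1 - s) *\<^sub>R u" "s *\<^sub>R (u + t *\<^sub>R v)"] s by simp
  also have "(1 - s) * norm u \<le> (1 - s) * M"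
    using u s by (intro mult_left_mono) auto
  finally have "M - \<epsilon>\<^sup>2 \<le> (1 - s) * M + s * norm (u + t *\<^sub>R v)"
    using uv by simp
  moreover have "\<epsilon>\<^sup>2 = s * (t * \<epsilon>)"
    using st by (simp add: power2_eq_square)
  ultimately have "s * (M - t * \<epsilon>) \<le> s * norm (u + t *\<^sub>R v)"
    by (simp add: algebra_simps)
  then show ?thesis
    using s by simp
qed

text \<open>
  Near maximisers of \<open>T + \<epsilon> \<beta> A\<close> are taken for \<open>\<epsilon> = 1 / (n + 1)\<close>, and compactness of the image
  of the unit ball under \<open>(T, A)\<close> supplies their limit \<open>x\<close>. Only the values \<open>T x\<close> and \<open>A x\<close>
  arise as limits; that \<open>x\<close> lies on the unit sphere follows from \<open>\<parallel>T\<parallel> \<le> \<parallel>T x\<parallel> \<le> \<parallel>T\<parallel> \<parallel>x\<parallel>\<close>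
  when \<open>T \<noteq> 0\<close>. For \<open>T = 0\<close> every unit vector will do, and a nonzero space has one.
\<close>

lemma one_sided_orthogonality_attained:
  fixes T A :: "'a::complex_normed_vector \<Rightarrow> 'b::complex_normed_vector"
  assumes nontrivial: "\<exists>x::'a. x \<noteq> 0"
    and refl: "reflexive_space TYPE('a)"
    and T: "T \<in> compact_operators" and A: "A \<in> compact_operators"
    and orth: "\<And>t::real. 0 \<le> t \<Longrightarrow>
      onorm T \<le> onorm (\<lambda>x. T x + (complex_of_real t * \<beta>) *\<^sub>C A x)"
  obtains x where "x \<in> norm_attaining_set T" "A x \<in> plus_part (T x) \<beta>"
proof -
  have blT: "bounded_linear T" and blA: "bounded_linear A"
    using T A by (auto intro: compact_operator_bounded_linear)
  have scale: "(complex_of_real t * \<beta>) *\<^sub>C v = t *\<^sub>R (\<beta> *\<^sub>C v)" for t and v :: 'b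
    by (simp add: scaleR_scaleC scaleC_scaleC)
  show thesis
  proof (cases "onorm T = 0")
    case True
    obtain y :: 'a where "y \<noteq> 0" using nontrivial by blast
    have "T x = 0" for x
      using onorm[OF blT, of x] True by simp
    then show thesis
      using True \<open>y \<noteq> 0\<close>
      by (intro that[of "y /\<^sub>R norm y"]) (auto simp: norm_attaining_set_def plus_part_def)
  next
    case False
    define M where "M = onorm T"
    have "0 < M"
      using False onorm_pos_le[OF blT] by (simp add: M_def)
    define \<epsilon> where "\<epsilon> n = inverse (real (Suc n))" for n
    have \<epsilon>: "0 < \<epsilon> n" for n by (simp add: \<epsilon>_def)
    have \<epsilon>_lim: "\<epsilon> \<longlonglongrightarrow> 0"
      unfolding \<epsilon>_def by (rule LIMSEQ_inverse_real_of_nat)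
    have bl: "bounded_linear (\<lambda>x. T x + c *\<^sub>C A x)" for c
      by (intro bounded_linear_add blT bounded_linear_compose[OF bounded_linear_scaleC blA])
    have "\<exists>x. norm x \<le> 1 \<and> M - (\<epsilon> n)\<^sup>2 \<le> norm (T x + \<epsilon> n *\<^sub>R (\<beta> *\<^sub>C A x))" for n
    proof -
      obtain x where "norm x \<le> 1"
        "onorm (\<lambda>x. T x + (complex_of_real (\<epsilon> n) * \<beta>) *\<^sub>C A x) - (\<epsilon> n)\<^sup>2
          \<le> norm (T x + (complex_of_real (\<epsilon> n) * \<beta>) *\<^sub>C A x)"
        using exists_near_maximiser[OF bl, of "(\<epsilon> n)\<^sup>2"] \<epsilon>[of n] by (metis zero_less_power)
      then show ?thesis
        using orth[of "\<epsilon> n"] \<epsilon>[of n] by (intro exI[of _ x]) (auto simp: scale M_def)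
    qed
    then obtain X where X: "\<And>n. norm (X n) \<le> 1"
      and X_max: "\<And>n. M - (\<epsilon> n)\<^sup>2 \<le> norm (T (X n) + \<epsilon> n *\<^sub>R (\<beta> *\<^sub>C A (X n)))"
      by metis
    obtain z r where z: "z \<in> (\<lambda>x. (T x, A x)) ` cball 0 1" and r: "strict_mono r"
      and lim: "((\<lambda>n. (T (X n), A (X n))) \<circ> r) \<longlonglongrightarrow> z"
      using compact_image_unit_ball_pair[OF refl T A] X
      unfolding compact_def by (metis (no_types, lifting) imageI mem_cball_0)
    then obtain x where x: "norm x \<le> 1" "z = (T x, A x)"
      by auto
    have limT: "(\<lambda>n. T (X (r n))) \<longlonglongrightarrow> T x"
      using tendsto_fst[OF lim] by (simp add: x o_def)
    have limA: "(\<lambda>n. \<beta> *\<^sub>C A (X (r n))) \<longlonglongrightarrow> \<beta> *\<^sub>C A x"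
      using bounded_linear.tendsto[OF bounded_linear_scaleC tendsto_snd[OF lim]]
      by (simp add: x o_def)
    have lim\<epsilon>: "(\<lambda>n. \<epsilon> (r n)) \<longlonglongrightarrow> 0"
      using LIMSEQ_subseq_LIMSEQ[OF \<epsilon>_lim r] by (simp add: o_def)
    have Tx_le: "norm (T x) \<le> M * norm x" for x
      unfolding M_def by (rule onorm[OF blT])
    have "(\<lambda>n. M - (\<epsilon> (r n))\<^sup>2) \<longlonglongrightarrow> M - 0\<^sup>2"
      by (intro tendsto_intros lim\<epsilon>)
    moreover have "(\<lambda>n. norm (T (X (r n)) + \<epsilon> (r n) *\<^sub>R (\<beta> *\<^sub>C A (X (r n)))))
        \<longlonglongrightarrow> norm (T x + 0 *\<^sub>R (\<beta> *\<^sub>C A x))"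
      by (intro tendsto_intros limT limA lim\<epsilon>)
    ultimately have "M - 0\<^sup>2 \<le> norm (T x + 0 *\<^sub>R (\<beta> *\<^sub>C A x))"
      by (rule LIMSEQ_le) (auto intro: X_max)
    then have Tx: "M \<le> norm (T x)" by simp
    have "norm x = 1"
    proof (rule antisym[OF x(1)])
      have "M * 1 \<le> M * norm x"
        using Tx Tx_le[of x] by simp
      then show "1 \<le> norm x"
        using \<open>0 < M\<close> by (simp only: mult_le_cancel_left_pos)
    qed
    then have TxM: "norm (T x) = M"
      using Tx Tx_le[of x] by simp
    have "M \<le> norm (T x + t *\<^sub>R (\<beta> *\<^sub>C A x))" if "0 < t" for t
    proof -
      have "norm (T (X n)) \<le> M" for n
        using Tx_le[of "X n"] X[of n] \<open>0 < M\<close> by (meson mult_left_le order.trans less_imp_le)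
      then have step: "M - t * \<epsilon> (r n) \<le> norm (T (X (r n)) + t *\<^sub>R (\<beta> *\<^sub>C A (X (r n))))"
        if "\<epsilon> (r n) < t" for n
        using \<epsilon> that X_max by (intro norm_line_lower_bound) auto
      have "\<forall>\<^sub>F n in sequentially. \<epsilon> (r n) < t"
        using order_tendstoD(2)[OF lim\<epsilon> \<open>0 < t\<close>] .
      then have "\<forall>\<^sub>F n in sequentially.
          M - t * \<epsilon> (r n) \<le> norm (T (X (r n)) + t *\<^sub>R (\<beta> *\<^sub>C A (X (r n))))"
        by (rule eventually_mono) (rule step)
      moreover have "(\<lambda>n. M - t * \<epsilon> (r n)) \<longlonglongrightarrow> M - t * 0"
        by (intro tendsto_intros lim\<epsilon>)
      moreover have "(\<lambda>n. norm (T (X (r n)) + t *\<^sub>R (\<beta> *\<^sub>C A (X (r n)))))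
          \<longlonglongrightarrow> norm (T x + t *\<^sub>R (\<beta> *\<^sub>C A x))"
        by (intro tendsto_intros limT limA)
      ultimately show ?thesis
        using tendsto_le[OF sequentially_bot] by fastforce
    qed
    then have "A x \<in> plus_part (T x) \<beta>"
      unfolding plus_part_def scale using TxM by (force simp: le_less)
    moreover have "x \<in> norm_attaining_set T"
      using \<open>norm x = 1\<close> TxM by (simp add: norm_attaining_set_def M_def)
    ultimately show thesis by (rule that[rotated])
  qed
qed

lemma plus_part_uminus: "plus_part u (- \<alpha>) = minus_part u \<alpha>"
proof -
  have "(\<forall>t::real. 0 \<le> t \<longrightarrow> P (- t)) \<longleftrightarrow> (\<forall>t. t \<le> 0 \<longrightarrow> P t)" for P
    by (metis minus_minus neg_0_le_iff_le)
  from this[of "\<lambda>t. norm u \<le> norm (u + (complex_of_real t * \<alpha>) *\<^sub>C v)" for v]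
  show ?thesis by (simp add: plus_part_def minus_part_def)
qed

text \<open>
  Arguments in \<open>[0, pi)\<close> are used as they are; for the others the sign of the real factor is
  changed, which rotates the argument by \<open>pi\<close>.
\<close>

lemma polar_upper_unit_arc:
  obtains t :: real and \<alpha> where "\<alpha> \<in> upper_unit_arc" "c = complex_of_real t * \<alpha>"
proof -
  have c: "c = complex_of_real (cmod c) * exp (\<i> * Arg c)"
    by (cases "c = 0") (auto simp: Arg_eq)
  have unit: "exp (\<i> * complex_of_real \<theta>) \<in> upper_unit_arc" if "0 \<le> \<theta>" "\<theta> < pi" for \<theta>
    using that Arg_unique[of 1 \<theta> "exp (\<i> * complex_of_real \<theta>)"] by (simp add: upper_unit_arc_def)
  consider "0 \<le> Arg c \<and> Arg c < pi" | "Arg c = pi" | "Arg c < 0"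
    using Arg_le_pi[of c] by linarith
  then show thesis
  proof cases
    case 1
    then show thesis using that[OF unit c] by blast
  next
    case 2
    then have "c = complex_of_real (- cmod c) * exp (\<i> * complex_of_real 0)"
      using c by (simp add: exp_pi_i')
    then show thesis using that[OF unit, of 0 "- cmod c"] by simp
  next
    case 3
    have "exp (\<i> * complex_of_real (Arg c + pi)) = - exp (\<i> * Arg c)"
      by (simp add: distrib_left exp_add exp_pi_i')
    then have "c = complex_of_real (- cmod c) * exp (\<i> * complex_of_real (Arg c + pi))"
      using c by simp
    then show thesis using that[OF unit, of "Arg c + pi" "- cmod c"] 3 mpi_less_Arg[of c] by simp
  qed
qed

theorem theorem2p4:
  fixes T A :: "'a::complex_banach \<Rightarrow> 'b::complex_banach"
  assumes nontrivial: "\<exists>x::'a. x \<noteq> 0"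
    and reflexive: "reflexive_space TYPE('a)"
    and T: "T \<in> compact_operators"
    and A: "A \<in> compact_operators"
  shows "T \<bottom>\<^sub>B A \<longleftrightarrow>
    (\<forall>\<alpha>\<in>upper_unit_arc. \<exists>x\<in>norm_attaining_set T. \<exists>y\<in>norm_attaining_set T.
       A x \<in> plus_part (T x) \<alpha> \<and> A y \<in> minus_part (T y) \<alpha>)"
proof
  assume orth: "T \<bottom>\<^sub>B A"
  have "\<exists>x\<in>norm_attaining_set T. A x \<in> plus_part (T x) \<beta>" for \<beta>
  proof -
    have "onorm T \<le> onorm (\<lambda>x. T x + (complex_of_real t * \<beta>) *\<^sub>C A x)" for t
      using orth by (simp add: birkhoff_james_orthogonal_def)
    then show ?thesis
      using one_sided_orthogonality_attained[OF nontrivial reflexive T A] by metis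
  qed
  then show "\<forall>\<alpha>\<in>upper_unit_arc. \<exists>x\<in>norm_attaining_set T. \<exists>y\<in>norm_attaining_set T.
       A x \<in> plus_part (T x) \<alpha> \<and> A y \<in> minus_part (T y) \<alpha>"
    by (metis plus_part_uminus)
next
  assume parts: "\<forall>\<alpha>\<in>upper_unit_arc. \<exists>x\<in>norm_attaining_set T. \<exists>y\<in>norm_attaining_set T.
       A x \<in> plus_part (T x) \<alpha> \<and> A y \<in> minus_part (T y) \<alpha>"
  show "T \<bottom>\<^sub>B A"
    unfolding birkhoff_james_orthogonal_def
  proof
    fix c
    obtain t \<alpha> where \<alpha>: "\<alpha> \<in> upper_unit_arc" and c: "c = complex_of_real t * \<alpha>"
      by (rule polar_upper_unit_arc)
    obtain x where x: "x \<in> norm_attaining_set T" "norm (T x) \<le> norm (T x + c *\<^sub>C A x)"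
      using parts \<alpha> unfolding c plus_part_def minus_part_def
      by (cases "0 \<le> t") fastforce+
    have "bounded_linear (\<lambda>x. T x + c *\<^sub>C A x)"
      using T A by (intro bounded_linear_add bounded_linear_compose[OF bounded_linear_scaleC]
          compact_operator_bounded_linear)
    from onorm[OF this, of x] x
    show "onorm T \<le> onorm (\<lambda>x. T x + c *\<^sub>C A x)"
      by (simp add: norm_attaining_set_def)
  qed
qed

end
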